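(* Let $\alpha\in\mathbb Z\setminus\{0,1\}$ and let $(h_n)$ be the sequence with $h_0=0$, $h_1=1$, $h_2=-\alpha^2(\alpha-1)$, $h_3=-\alpha^6(\alpha-1)^3$, $h_4=\alpha^{11}(\alpha-1)^6$, and for $m\ge2$: $h_{2m+1}=h_{m+2}h_m^3-h_{m-1}h_{m+1}^3$, for $m\ge 3$: $h_{2m}=h_m\big(h_{m+2}h_{m-1}^2-h_{m-2}h_{m+1}^2\big)/h_2$. (i) If $n\equiv 2,3,11,12\pmod{14}$, then $h_n$ is a square if and only if $\alpha-1$ is a square. (ii) If $n\equiv 4,5,9,10\pmod{14}$, then $h_n$ is a square if and only if $\alpha$ is a square. (iii) If $n\equiv 4,6,10,11,15,17\pmod{21}$, then $h_n$ is a cube if and only if $\alpha$ is a cube. (iv) If $n\equiv 9,12\pmod{21}$, then $h_n$ is a cube if and only if $\alpha-1$ is a cube.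
   Context: The sequence defined is the elliptic divisibility sequence attached to the point $(0,0)$ of order $7$ on the Tate normal form curve with $b=\alpha^3-\alpha^2$, $c=\alpha^2-\alpha$. Convention: an integer $m$ is called a square if $m=\pm\beta^2$ for some nonzero integer $\beta$, and a cube if $m=\beta^3$ for some nonzero integer $\beta$. *)

theory Defs
  imports Complex_Main
begin

text \<open>Squares are taken up to sign, and zero counts neither as a square nor as a cube.\<close>

definition signed_square :: "int \<Rightarrow> bool" where
  "signed_square m \<longleftrightarrow> (\<exists>\<beta>::int. \<beta> \<noteq> 0 \<and> (m = \<beta>^2 \<or> m = - (\<beta>^2)))"

definition nonzero_cube :: "int \<Rightarrow> bool" where
  "nonzero_cube m \<longleftrightarrow> (\<exists>\<beta>::int. \<beta> \<noteq> 0 \<and> m = \<beta>^3)"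

text \<open>
  The sequence is rational-valued, so that the division by its second term is a genuine
  one and integrality of the terms is not assumed. A rational number is a square or a cube
  if it is an integer which is one.
\<close>

definition rat_signed_square :: "rat \<Rightarrow> bool" where
  "rat_signed_square x \<longleftrightarrow> (\<exists>m::int. x = of_int m \<and> signed_square m)"

definition rat_nonzero_cube :: "rat \<Rightarrow> bool" where
  "rat_nonzero_cube x \<longleftrightarrow> (\<exists>m::int. x = of_int m \<and> nonzero_cube m)"

end

theory Submission
  imports Defs
begin

text \<open>
  Since the point has order 7, the sequence is quasi-periodic: with \<open>w = \<alpha>^5 (\<alpha> - 1)^3\<close> one has
  \<open>h (n + 7) = w^(2n + 7) h n\<close>. Both defining recurrences are compatible with this shift, so it
  suffices to check them at seven consecutive indices. Iterating the shift, \<open>h (n + 14)\<close> is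
  \<open>h n\<close> times a square and \<open>h (n + 21)\<close> is \<open>h n\<close> times a cube, which reduces the
  theorem to finitely many terms, each of them a signed monomial in \<open>\<alpha>\<close> and \<open>\<alpha> - 1\<close>.
\<close>

section \<open>The explicit quasi-periodic sequence and its shifts\<close>

fun eds7 :: "int \<Rightarrow> int \<Rightarrow> nat \<Rightarrow> int" where
  "eds7 a b n =
     (if n = 0 then 0
      else if n = 1 then 1
      else if n = 2 then - (a^2 * b)
      else if n = 3 then - (a^6 * b^3)
      else if n = 4 then a^11 * b^6
      else if n = 5 then a^17 * b^10
      else if n = 6 then - (a^25 * b^15)
      else eds7 a b (n - 7) * (a^5 * b^3)^(2 * (n - 7) + 7))"

declare eds7.simps [simp del]

lemma eds7_base:
  "eds7 a b 0 = 0"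
  "eds7 a b (Suc 0) = 1"
  "eds7 a b 2 = - (a^2 * b)"
  "eds7 a b 3 = - (a^6 * b^3)"
  "eds7 a b 4 = a^11 * b^6"
  "eds7 a b 5 = a^17 * b^10"
  "eds7 a b 6 = - (a^25 * b^15)"
  by (simp_all add: eds7.simps)

lemma eds7_add7: "eds7 a b (n + 7) = eds7 a b n * (a^5 * b^3)^(2 * n + 7)"
  by (subst eds7.simps) simp

text \<open>A single shift contributes an odd power, but the exponents \<open>2 * n + 7\<close> and
  \<open>2 * (n + 7) + 7\<close> of two consecutive shifts add up to
  \<open>2 * (2 * n + 14)\<close>.\<close>

lemma eds7_add14: "eds7 a b (n + 14) = eds7 a b n * ((a^5 * b^3)^(2 * n + 14))^2"
  using eds7_add7[of a b n] eds7_add7[of a b "n + 7"]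
  by (simp add: power_add[symmetric] power_mult[symmetric] mult.assoc add.commute)

text \<open>The third shift raises the total exponent to \<open>6 * n + 63\<close>, which is three
  times \<open>2 * n + 21\<close>.\<close>

lemma eds7_add21: "eds7 a b (n + 21) = eds7 a b n * ((a^5 * b^3)^(2 * n + 21))^3"
  using eds7_add7[of a b "n + 14"]
  by (simp add: eds7_add14 power_add[symmetric] power_mult[symmetric] mult.assoc add.commute)

text \<open>The range is what the seven base cases of the recurrences reach, up to
  \<open>2 * 6 + 5\<close>; it also contains every residue above 6 that occurs in the
  theorem.\<close>

lemma eds7_values:
  "eds7 a b 7 = 0"
  "eds7 a b 8 = a^45 * b^27"
  "eds7 a b 9 = - (a^57 * b^34)"
  "eds7 a b 10 = - (a^71 * b^42)"
  "eds7 a b 11 = a^86 * b^51"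
  "eds7 a b 12 = a^102 * b^61"
  "eds7 a b 13 = - (a^120 * b^72)"
  "eds7 a b 14 = 0"
  "eds7 a b 15 = a^160 * b^96"
  "eds7 a b 16 = - (a^182 * b^109)"
  "eds7 a b 17 = - (a^206 * b^123)"
  by (simp_all add: eds7.simps) algebra+

section \<open>The recurrences hold for the explicit sequence and determine it\<close>

lemma induct_step7 [case_names 0 1 2 3 4 5 6 step]:
  fixes P :: "nat \<Rightarrow> bool"
  assumes "P 0" "P (Suc 0)" "P 2" "P 3" "P 4" "P 5" "P 6" and step: "\<And>n. P n \<Longrightarrow> P (n + 7)"
  shows "P n"
proof (induction n rule: less_induct)
  case (less n)
  show ?case
  proof (cases "n < 7")
    case True
    then have "n \<in> {0, Suc 0, 2, 3, 4, 5, 6}" by auto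
    then show ?thesis using assms(1-7) by blast
  next
    case False
    then show ?thesis using less.IH[of "n - 7"] step[of "n - 7"] by simp
  qed
qed

text \<open>Here \<open>k\<close> is \<open>m - 2\<close>, which avoids truncated subtraction. The
  variables \<open>a\<close> and \<open>b\<close> stay separate so that all terms are monomials;
  \<open>a = b + 1\<close> enters where two different monomials must combine into one.\<close>

lemma eds7_odd:
  assumes "a = b + 1"
  shows "eds7 a b (2 * k + 5) =
    eds7 a b (k + 4) * eds7 a b (k + 2)^3 - eds7 a b (k + 1) * eds7 a b (k + 3)^3"
proof (induction k rule: induct_step7)
  case (step k)
  define w where "w = a^5 * b^3"
  have shift: "eds7 a b (n + 7) = eds7 a b n * w^(2 * n + 7)" for n
    unfolding w_def by (rule eds7_add7)
  \<comment> \<open>Raising \<open>k\<close> by 7 shifts the left side twice. All three products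
    acquire the same power of \<open>w\<close>: \<open>(4 * k + 17) + (4 * k + 31)\<close>,
    \<open>(2 * k + 15) + 3 * (2 * k + 11)\<close> and \<open>(2 * k + 9) + 3 * (2 * k + 13)\<close>
    all equal \<open>8 * k + 48\<close>.\<close>
  have "eds7 a b (2 * (k + 7) + 5) = eds7 a b (2 * k + 5) * w^(8 * k + 48)"
    using shift[of "2 * k + 5"] shift[of "2 * k + 12"]
    by (simp add: mult.assoc power_add[symmetric] add.commute)
  moreover have "eds7 a b (k + 7 + 4) * eds7 a b (k + 7 + 2)^3
      = eds7 a b (k + 4) * eds7 a b (k + 2)^3 * w^(8 * k + 48)"
    using shift[of "k + 4"] shift[of "k + 2"]
    by (simp add: power_mult_distrib mult.commute mult.left_commute
          power_mult[symmetric] power_add[symmetric] add.commute)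
  moreover have "eds7 a b (k + 7 + 1) * eds7 a b (k + 7 + 3)^3
      = eds7 a b (k + 1) * eds7 a b (k + 3)^3 * w^(8 * k + 48)"
    using shift[of "k + 1"] shift[of "k + 3"]
    by (simp add: power_mult_distrib mult.commute mult.left_commute
          power_mult[symmetric] power_add[symmetric] add.commute)
  ultimately show ?case using step by (simp add: left_diff_distrib)
next
  case 0
  \<comment> \<open>Up to the common factor \<open>b^9\<close>, this is the identity to be
    checked.\<close>
  have "a^18 = a^17 * b + a^17" using assms by algebra
  then show ?case by (simp add: eds7_base numeral_2_eq_2[symmetric]) algebra
next
  case 2
  have "a^58 = a^57 * b + a^57" using assms by algebra
  then show ?case by (simp add: eds7_base eds7_values) algebra
\<comment> \<open>For \<open>k = 1\<close> the two monomials cancel; from \<open>k = 3\<close> on,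
  one product contains the vanishing term at index 7.\<close>
qed (simp_all add: eds7_base eds7_values numeral_2_eq_2[symmetric], algebra+)

text \<open>Multiplying through by the second term keeps the identity in the integers. Again
  \<open>k\<close> is \<open>m - 2\<close>, and every term acquires the power
  \<open>8 * k + 44\<close> of \<open>w\<close>.\<close>

lemma eds7_even:
  assumes "a = b + 1"
  shows "eds7 a b (2 * k + 4) * eds7 a b 2 = eds7 a b (k + 2) *
    (eds7 a b (k + 4) * eds7 a b (k + 1)^2 - eds7 a b k * eds7 a b (k + 3)^2)"
proof (induction k rule: induct_step7)
  case (step k)
  define w where "w = a^5 * b^3"
  have shift: "eds7 a b (n + 7) = eds7 a b n * w^(2 * n + 7)" for n
    unfolding w_def by (rule eds7_add7)
  have "eds7 a b (2 * (k + 7) + 4) = eds7 a b (2 * k + 4) * w^(8 * k + 44)"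
    using shift[of "2 * k + 4"] shift[of "2 * k + 11"]
    by (simp add: mult.assoc power_add[symmetric] add.commute)
  moreover have "eds7 a b (k + 7 + 2) * (eds7 a b (k + 7 + 4) * eds7 a b (k + 7 + 1)^2)
      = eds7 a b (k + 2) * (eds7 a b (k + 4) * eds7 a b (k + 1)^2) * w^(8 * k + 44)"
    using shift[of "k + 4"] shift[of "k + 2"] shift[of "k + 1"]
    by (simp add: power_mult_distrib mult.commute mult.left_commute
          power_mult[symmetric] power_add[symmetric] add.commute)
  moreover have "eds7 a b (k + 7 + 2) * (eds7 a b (k + 7) * eds7 a b (k + 7 + 3)^2)
      = eds7 a b (k + 2) * (eds7 a b k * eds7 a b (k + 3)^2) * w^(8 * k + 44)"
    using shift[of "k + 2"] shift[of k] shift[of "k + 3"]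
    by (simp add: power_mult_distrib mult.commute mult.left_commute
          power_mult[symmetric] power_add[symmetric] add.commute)
  moreover have "eds7 a b (2 * k + 4) * w^(8 * k + 44) * eds7 a b 2
      = eds7 a b (2 * k + 4) * eds7 a b 2 * w^(8 * k + 44)"
    by simp
  ultimately show ?case
    by (simp only: step right_diff_distrib left_diff_distrib)
next
  case 1
  have "a^28 = a^27 * b + a^27" using assms by algebra
  then show ?case
    by (simp add: eds7_base numeral_2_eq_2[symmetric] numeral_3_eq_3[symmetric]) algebra
next
  case 2
  have "a^48 = a^47 * b + a^47" using assms by algebra
  then show ?case by (simp add: eds7_base eds7_values) algebra
\<comment> \<open>In each remaining case a term at index 0 or 7 removes at least one of the two
  products.\<close>
qed (simp_all add: eds7_base eds7_values numeral_2_eq_2[symmetric], algebra+)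

text \<open>Each recurrence expresses a term beyond index 4 through strictly earlier ones, and the
  divisor \<open>h 2\<close> is nonzero because \<open>a\<close> and \<open>b\<close> are.\<close>

lemma eds7_unique:
  fixes h :: "nat \<Rightarrow> rat"
  assumes "a = b + 1" and "a \<noteq> 0" and "b \<noteq> 0"
    and init: "\<And>n. n \<le> 4 \<Longrightarrow> h n = of_int (eds7 a b n)"
    and odd: "\<And>m. m \<ge> 2 \<Longrightarrow> h (2 * m + 1) = h (m + 2) * h m ^ 3 - h (m - 1) * h (m + 1) ^ 3"
    and even: "\<And>m. m \<ge> 3 \<Longrightarrow>
      h (2 * m) = h m * (h (m + 2) * h (m - 1) ^ 2 - h (m - 2) * h (m + 1) ^ 2) / h 2"
  shows "h n = of_int (eds7 a b n)"
proof (induction n rule: less_induct)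
  case (less n)
  \<comment> \<open>The even case corresponds to \<open>m = k + 3\<close>, the first index allowed
    by the even recurrence being 6; the form \<open>2 * (k + 1) + 4\<close> matches
    \<open>eds7_even\<close> at \<open>k + 1\<close>.\<close>
  consider "n \<le> 4" | k where "n = 2 * k + 5" | k where "n = 2 * (k + 1) + 4"
  proof (cases "n \<le> 4")
    case False
    show ?thesis
    proof (cases "even n")
      case True
      then obtain m where "n = 2 * m" by blast
      with False have "n = 2 * (m - 3 + 1) + 4" by simp
      then show ?thesis by (rule that(3))
    next
      case odd_n: False
      then obtain m where "n = 2 * m + 1" by (rule oddE)
      with False have "n = 2 * (m - 2) + 5" by simp
      then show ?thesis by (rule that(2))
    qed
  qed (rule that(1))
  then show ?case
  proof cases
    case 1
    then show ?thesis by (rule init)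
  next
    case (2 k)
    have "h n = h (k + 4) * h (k + 2) ^ 3 - h (k + 1) * h (k + 3) ^ 3"
      using odd[of "k + 2"] 2 by (simp add: numeral_eq_Suc)
    then show ?thesis
      using less.IH[of "k + 4"] less.IH[of "k + 3"] less.IH[of "k + 2"] less.IH[of "k + 1"]
        eds7_odd[OF assms(1), of k] 2
      by simp
  next
    case (3 k)
    have "h n = h (k + 3) * (h (k + 5) * h (k + 2) ^ 2 - h (k + 1) * h (k + 4) ^ 2) / h 2"
      using even[of "k + 3"] 3 by (simp add: numeral_eq_Suc)
    also have "\<dots> = of_int (eds7 a b (k + 3) *
        (eds7 a b (k + 5) * eds7 a b (k + 2)^2 - eds7 a b (k + 1) * eds7 a b (k + 4)^2))
          / of_int (eds7 a b 2)"
      using less.IH[of "k + 5"] less.IH[of "k + 4"] less.IH[of "k + 3"] less.IH[of "k + 2"]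
        less.IH[of "k + 1"] init[of 2] 3
      by simp
    also have "\<dots> = of_int (eds7 a b n * eds7 a b 2) / of_int (eds7 a b 2)"
      using eds7_even[OF assms(1), of "k + 1"] 3 by (simp add: numeral_eq_Suc)
    also have "\<dots> = of_int (eds7 a b n)"
      using assms(2,3) by (simp add: eds7_base)
    finally show ?thesis .
  qed
qed

section \<open>Removing signs, square factors and cube factors\<close>

lemma signed_square_minus [simp]: "signed_square (- m) \<longleftrightarrow> signed_square m"
  unfolding signed_square_def by (metis minus_equation_iff)

lemma nonzero_cube_minus [simp]: "nonzero_cube (- m) \<longleftrightarrow> nonzero_cube m"
proof -
  have "nonzero_cube (- m)" if "nonzero_cube m" for m
  proof -
    from that obtain c where "c \<noteq> 0" "m = c^3" unfolding nonzero_cube_def by blast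
    then have "- c \<noteq> 0 \<and> - m = (- c)^3" by simp
    then show ?thesis unfolding nonzero_cube_def by blast
  qed
  from this[of m] this[of "- m"] show ?thesis by auto
qed

lemma signed_square_mult_square [simp]:
  assumes "k \<noteq> 0"
  shows "signed_square (m * k^2) \<longleftrightarrow> signed_square m"
proof
  assume "signed_square (m * k^2)"
  then obtain c where c: "c \<noteq> 0" "m * k^2 = c^2 \<or> m * k^2 = - (c^2)"
    unfolding signed_square_def by blast
  then have "k^2 dvd c^2" by (metis dvd_minus_iff dvd_triv_right)
  \<comment> \<open>Over the integers, divisibility of squares passes to their roots.\<close>
  then obtain d where d: "c = k * d" by (auto elim: dvdE)
  with c assms have "d \<noteq> 0 \<and> (m = d^2 \<or> m = - (d^2))"
    \<comment> \<open>The sign is moved into the second factor so that \<open>k^2\<close> cancels in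
      the negative case as well.\<close>
    by (auto simp: power_mult_distrib minus_mult_right simp del: mult_minus_right)
  then show "signed_square m" unfolding signed_square_def by blast
next
  assume "signed_square m"
  then obtain c where "c \<noteq> 0" "m = c^2 \<or> m = - (c^2)" unfolding signed_square_def by blast
  with assms have "c * k \<noteq> 0 \<and> (m * k^2 = (c * k)^2 \<or> m * k^2 = - ((c * k)^2))"
    by (auto simp: power_mult_distrib)
  then show "signed_square (m * k^2)" unfolding signed_square_def by blast
qed

lemma nonzero_cube_mult_cube [simp]:
  assumes "k \<noteq> 0"
  shows "nonzero_cube (m * k^3) \<longleftrightarrow> nonzero_cube m"
proof
  assume "nonzero_cube (m * k^3)"
  then obtain c where c: "c \<noteq> 0" "m * k^3 = c^3" unfolding nonzero_cube_def by blast
  then have "k^3 dvd c^3" by (metis dvd_triv_right)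
  then obtain d where d: "c = k * d" by (auto elim: dvdE)
  with c assms have "d \<noteq> 0 \<and> m = d^3" by (auto simp: power_mult_distrib)
  then show "nonzero_cube m" unfolding nonzero_cube_def by blast
next
  assume "nonzero_cube m"
  then obtain c where "c \<noteq> 0" "m = c^3" unfolding nonzero_cube_def by blast
  with assms have "c * k \<noteq> 0 \<and> m * k^3 = (c * k)^3" by (auto simp: power_mult_distrib)
  then show "nonzero_cube (m * k^3)" unfolding nonzero_cube_def by blast
qed

text \<open>Needed for monomials whose exponent of \<open>a\<close> is 2 modulo 3. Squaring once
  more gives \<open>a^4\<close>, which is \<open>a\<close> up to the cube
  \<open>a^3\<close>.\<close>

lemma nonzero_cube_square:
  assumes "a \<noteq> 0"
  shows "nonzero_cube (a^2) \<longleftrightarrow> nonzero_cube a"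
proof
  assume "nonzero_cube (a^2)"
  then obtain c where c: "c \<noteq> 0" "a^2 = c^3" unfolding nonzero_cube_def by blast
  have "a * a^3 = (a^2)^2" by algebra
  also have "\<dots> = (c^2)^3" unfolding c(2) by algebra
  finally have "c^2 \<noteq> 0 \<and> a * a^3 = (c^2)^3" using c(1) by simp
  then have "nonzero_cube (a * a^3)" unfolding nonzero_cube_def by blast
  then show "nonzero_cube a" using assms by simp
next
  assume "nonzero_cube a"
  then obtain c where "c \<noteq> 0" "a = c^3" unfolding nonzero_cube_def by blast
  then have "c^2 \<noteq> 0 \<and> a^2 = (c^2)^3" by (simp add: power_mult[symmetric])
  then show "nonzero_cube (a^2)" unfolding nonzero_cube_def by blast
qed

lemma rat_signed_square_of_int [simp]: "rat_signed_square (of_int m) \<longleftrightarrow> signed_square m"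
  unfolding rat_signed_square_def by auto

lemma rat_nonzero_cube_of_int [simp]: "rat_nonzero_cube (of_int m) \<longleftrightarrow> nonzero_cube m"
  unfolding rat_nonzero_cube_def by auto

section \<open>Reduction to residues and to monomials\<close>

lemma signed_square_eds7_mod14:
  assumes "a \<noteq> 0" and "b \<noteq> 0"
  shows "signed_square (eds7 a b n) \<longleftrightarrow> signed_square (eds7 a b (n mod 14))"
proof (induction n rule: less_induct)
  case (less n)
  show ?case
  proof (cases "n < 14")
    case False
    then obtain k where "n = k + 14" by (metis add.commute le_Suc_ex not_less)
    with less.IH[of k] assms show ?thesis by (simp add: eds7_add14)
  qed simp
qed

lemma nonzero_cube_eds7_mod21:
  assumes "a \<noteq> 0" and "b \<noteq> 0"
  shows "nonzero_cube (eds7 a b n) \<longleftrightarrow> nonzero_cube (eds7 a b (n mod 21))"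
proof (induction n rule: less_induct)
  case (less n)
  show ?case
  proof (cases "n < 21")
    case False
    then obtain k where "n = k + 21" by (metis add.commute le_Suc_ex not_less)
    with less.IH[of k] assms show ?thesis by (simp add: eds7_add21)
  qed simp
qed

lemma signed_square_monomial:
  assumes "a \<noteq> 0" and "b \<noteq> 0"
  shows "signed_square (a^(2 * i) * b^(2 * j + 1)) \<longleftrightarrow> signed_square b"
    and "signed_square (a^(2 * i + 1) * b^(2 * j)) \<longleftrightarrow> signed_square a"
proof -
  have "a^(2 * i) * b^(2 * j + 1) = b * (a^i * b^j)^2"
    and "a^(2 * i + 1) * b^(2 * j) = a * (a^i * b^j)^2"
    by (simp_all add: power_mult_distrib power_mult[symmetric] mult.commute)
  then show "signed_square (a^(2 * i) * b^(2 * j + 1)) \<longleftrightarrow> signed_square b"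
    and "signed_square (a^(2 * i + 1) * b^(2 * j)) \<longleftrightarrow> signed_square a"
    using assms by (simp_all del: power_Suc)
qed

lemma nonzero_cube_monomial:
  assumes "a \<noteq> 0" and "b \<noteq> 0"
  shows "nonzero_cube (a^(3 * i) * b^(3 * j + 1)) \<longleftrightarrow> nonzero_cube b"
    and "nonzero_cube (a^(3 * i + 1) * b^(3 * j)) \<longleftrightarrow> nonzero_cube a"
    and "nonzero_cube (a^(3 * i + 2) * b^(3 * j)) \<longleftrightarrow> nonzero_cube a"
proof -
  have "a^(3 * i) * b^(3 * j + 1) = b * (a^i * b^j)^3"
    and "a^(3 * i + 1) * b^(3 * j) = a * (a^i * b^j)^3"
    and "a^(3 * i + 2) * b^(3 * j) = a^2 * (a^i * b^j)^3"
    by (simp_all add: power_mult_distrib power_mult[symmetric] power2_eq_square mult.commute)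
  then show "nonzero_cube (a^(3 * i) * b^(3 * j + 1)) \<longleftrightarrow> nonzero_cube b"
    and "nonzero_cube (a^(3 * i + 1) * b^(3 * j)) \<longleftrightarrow> nonzero_cube a"
    and "nonzero_cube (a^(3 * i + 2) * b^(3 * j)) \<longleftrightarrow> nonzero_cube a"
    using assms nonzero_cube_square[of a] by (simp_all del: power_Suc)
qed

theorem theorem5p9:
  fixes \<alpha> :: int and h :: "nat \<Rightarrow> rat"
  assumes "\<alpha> \<noteq> 0" and "\<alpha> \<noteq> 1"
    and "h 0 = 0"
    and "h 1 = 1"
    and "h 2 = of_int (- (\<alpha>^2) * (\<alpha> - 1))"
    and "h 3 = of_int (- (\<alpha>^6) * (\<alpha> - 1)^3)"
    and "h 4 = of_int (\<alpha>^11 * (\<alpha> - 1)^6)"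
    and "\<And>m. m \<ge> 2 \<Longrightarrow>
          h (2 * m + 1) = h (m + 2) * h m ^ 3 - h (m - 1) * h (m + 1) ^ 3"
    and "\<And>m. m \<ge> 3 \<Longrightarrow>
          h (2 * m) = h m * (h (m + 2) * h (m - 1) ^ 2 - h (m - 2) * h (m + 1) ^ 2) / h 2"
  shows "(\<forall>n. n mod 14 \<in> {2, 3, 11, 12} \<longrightarrow>
            (rat_signed_square (h n) \<longleftrightarrow> signed_square (\<alpha> - 1))) \<and>
         (\<forall>n. n mod 14 \<in> {4, 5, 9, 10} \<longrightarrow>
            (rat_signed_square (h n) \<longleftrightarrow> signed_square \<alpha>)) \<and>
         (\<forall>n. n mod 21 \<in> {4, 6, 10, 11, 15, 17} \<longrightarrow>
            (rat_nonzero_cube (h n) \<longleftrightarrow> nonzero_cube \<alpha>)) \<and>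
         (\<forall>n. n mod 21 \<in> {9, 12} \<longrightarrow>
            (rat_nonzero_cube (h n) \<longleftrightarrow> nonzero_cube (\<alpha> - 1)))"
proof -
  define b where "b = \<alpha> - 1"
  have nz: "\<alpha> \<noteq> 0" "b \<noteq> 0" using assms(1,2) by (simp_all add: b_def)
  have init: "h n = of_int (eds7 \<alpha> b n)" if "n \<le> 4" for n
  proof -
    from that have "n \<in> {0, 1, 2, 3, 4}" by auto
    then show ?thesis using assms(3-7) by (auto simp: eds7_base b_def)
  qed
  have h: "h n = of_int (eds7 \<alpha> b n)" for n
    using eds7_unique[of \<alpha> b h, OF _ nz init assms(8,9)] by (simp add: b_def)
  note square = signed_square_monomial[OF nz]
  note cube = nonzero_cube_monomial[OF nz]
  have "rat_signed_square (h n) \<longleftrightarrow> signed_square b" if "n mod 14 \<in> {2, 3, 11, 12}" for n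
    \<comment> \<open>The instances here and below follow the order of the residues and encode the
      exponents of the corresponding terms: \<open>43\<close> and \<open>25\<close>, for example,
      give \<open>a^86 * b^51\<close> at index 11.\<close>
    using that square(1)[of 1 0] square(1)[of 3 1] square(1)[of 43 25] square(1)[of 51 30]
    by (auto simp: h signed_square_eds7_mod14[OF nz, of n] eds7_base eds7_values)
  moreover have "rat_signed_square (h n) \<longleftrightarrow> signed_square \<alpha>" if "n mod 14 \<in> {4, 5, 9, 10}" for n
    using that square(2)[of 5 3] square(2)[of 8 5] square(2)[of 28 17] square(2)[of 35 21]
    by (auto simp: h signed_square_eds7_mod14[OF nz, of n] eds7_base eds7_values)
  moreover have "rat_nonzero_cube (h n) \<longleftrightarrow> nonzero_cube \<alpha>"
    if "n mod 21 \<in> {4, 6, 10, 11, 15, 17}" for n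
    \<comment> \<open>Residues 6 and 15 have exponent of \<alpha> equal to 1 modulo 3; the other
      four have 2 and go through \<open>nonzero_cube_square\<close>.\<close>
    using that cube(3)[of 3 2] cube(2)[of 8 5] cube(3)[of 23 14] cube(3)[of 28 17]
      cube(2)[of 53 32] cube(3)[of 68 41]
    by (auto simp: h nonzero_cube_eds7_mod21[OF nz, of n] eds7_base eds7_values)
  moreover have "rat_nonzero_cube (h n) \<longleftrightarrow> nonzero_cube b" if "n mod 21 \<in> {9, 12}" for n
    using that cube(1)[of 19 11] cube(1)[of 34 20]
    by (auto simp: h nonzero_cube_eds7_mod21[OF nz, of n] eds7_base eds7_values)
  ultimately show ?thesis unfolding b_def by blast
qed

end
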